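(* Let $R$ be a commutative ring with $1\neq 0$ and let $\tau$ be a symmetric relation on $R^{\#}$. Given $a\in \mathrm{Reg}(R)$, the following are equivalent. (1) For any $\tau$-regular-factorization $a=\lambda a_1\cdots a_n$, we have $a\sim a_i$ for some $1\le i\le n$. (2) For any $\tau$-regular-factorization $a=\lambda a_1\cdots a_n$, we have $a\approx a_i$ for some $1\le i\le n$. (3) For any $\tau$-regular-factorization $a=\lambda a_1\cdots a_n$, we have $a\sim a_i$ for all $1\le i\le n$. (4) The only $\tau$-regular-factorizations of $a$ are of the form $a=\lambda(\lambda^{-1}a)$ with $\lambda\in U(R)$. (5) $a\cong a$ and for any $\tau$-regular-factorization $a=\lambda a_1\cdots a_n$, we have $a\cong a_i$ for some $1\le i\le n$.
   Context: $U(R)$ is the group of units of $R$, $R^{\#}$ is the set of nonzero non-units of $R$, and $\mathrm{Reg}(R)$ is the set of regular elements (non-zero-divisors) of $R$. Associate relations: $a\sim b$ means $(a)=(b)$; $a\approx b$ means $a=\lambda b$ for some $\lambda\in U(R)$; $a\cong b$ means $a\sim b$ and either $a=b=0$ or, whenever $a=rb$ with $r\in R$, one has $r\in U(R)$. For a symmetric relation $\tau$ on $R^{\#}$, a $\tau$-factorization of a non-unit $a\in R$ is an expression $a=\lambda a_1\cdots a_n$ with $n\ge 1$, $\lambda\in U(R)$, each $a_i$ a non-unit of $R$, and $a_i\,\tau\,a_j$ for all $i\ne j$. It is trivial if $n=1$. It is called a $\tau$-regular-factorization (or $\tau$-$r$-factorization) if $a\in\mathrm{Reg}(R)$. *)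

theory Defs
  imports "HOL-Algebra.Ideal" "HOL-Algebra.Ring"
begin

definition nonunits :: "('a, 'm) ring_scheme \<Rightarrow> 'a set" where
  "nonunits R = carrier R - Units R"

definition nonzero_nonunits :: "('a, 'm) ring_scheme \<Rightarrow> 'a set" where
  "nonzero_nonunits R = nonunits R - {\<zero>\<^bsub>R\<^esub>}"

definition regular_elements :: "('a, 'm) ring_scheme \<Rightarrow> 'a set" where
  "regular_elements R =
     {a \<in> carrier R. \<forall>b \<in> carrier R. a \<otimes>\<^bsub>R\<^esub> b = \<zero>\<^bsub>R\<^esub> \<longrightarrow> b = \<zero>\<^bsub>R\<^esub>}"

(* The relation a ~ b: equality of principal ideals. *)
definition ideal_assoc :: "('a, 'm) ring_scheme \<Rightarrow> 'a \<Rightarrow> 'a \<Rightarrow> bool" where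
  "ideal_assoc R a b \<longleftrightarrow> PIdl\<^bsub>R\<^esub> a = PIdl\<^bsub>R\<^esub> b"

(* The relation written with a double tilde. *)
definition strong_assoc :: "('a, 'm) ring_scheme \<Rightarrow> 'a \<Rightarrow> 'a \<Rightarrow> bool" where
  "strong_assoc R a b \<longleftrightarrow> (\<exists>u \<in> Units R. a = u \<otimes>\<^bsub>R\<^esub> b)"

(* The relation written with a congruence sign; not reflexive in general,
   e.g. a = e * a for a nontrivial idempotent a = e. *)
definition very_strong_assoc :: "('a, 'm) ring_scheme \<Rightarrow> 'a \<Rightarrow> 'a \<Rightarrow> bool" where
  "very_strong_assoc R a b \<longleftrightarrow>
     ideal_assoc R a b \<and>
     ((a = \<zero>\<^bsub>R\<^esub> \<and> b = \<zero>\<^bsub>R\<^esub>) \<or>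
      (\<forall>r \<in> carrier R. a = r \<otimes>\<^bsub>R\<^esub> b \<longrightarrow> r \<in> Units R))"

(* The pair (u, as) records the expression a = u a_1 ... a_n with as = [a_1, ..., a_n].
   The condition on tau is indexed by positions, so a repeated factor must be
   tau-related to itself; for n = 1 it is void. *)
definition tau_factorization ::
  "('a, 'm) ring_scheme \<Rightarrow> ('a \<times> 'a) set \<Rightarrow> 'a \<Rightarrow> 'a \<Rightarrow> 'a list \<Rightarrow> bool" where
  "tau_factorization R \<tau> a u as \<longleftrightarrow>
     a \<in> nonunits R \<and> u \<in> Units R \<and> as \<noteq> [] \<and> set as \<subseteq> nonunits R \<and>
     (\<forall>i < length as. \<forall>j < length as. i \<noteq> j \<longrightarrow> (as ! i, as ! j) \<in> \<tau>) \<and>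
     a = u \<otimes>\<^bsub>R\<^esub> foldr (\<otimes>\<^bsub>R\<^esub>) as \<one>\<^bsub>R\<^esub>"

definition tau_regular_factorization ::
  "('a, 'm) ring_scheme \<Rightarrow> ('a \<times> 'a) set \<Rightarrow> 'a \<Rightarrow> 'a \<Rightarrow> 'a list \<Rightarrow> bool" where
  "tau_regular_factorization R \<tau> a u as \<longleftrightarrow>
     tau_factorization R \<tau> a u as \<and> a \<in> regular_elements R"

end

theory Submission
  imports Defs "HOL-Algebra.Divisibility"
begin

text \<open>
  Write a factorization of a as \<open>a = \<lambda> x b\<close>, where x is one chosen factor and b is the product
  of the others. If \<open>a \<sim> x\<close>, then x is a multiple of a, say \<open>x = s a\<close>, hence \<open>a = (\<lambda> s b) a\<close>.
  Because a is regular it can be cancelled, so b is a unit. A product of non-units is a unit only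
  when it is empty; hence x is the only factor, and the factorization is the trivial one.

  Conversely, in a trivial factorization \<open>a = \<lambda> x\<close> the single factor is related to a by all
  three associate relations. For the strongest of them, regularity is used once more:
  \<open>a = r x\<close> and \<open>a = \<lambda> x\<close> force \<open>r = \<lambda>\<close>.

  Thus for each individual factorization of a, and each of the three relations, the following
  are the same: some factor is related to a; every factor is related to a; the factorization is
  trivial. The lemma \<open>related_factor_iff_trivial\<close> isolates this, with an arbitrary relation
  between strong and ideal-theoretic associateness, and the equivalence of all five conditions
  follows. The extra clause \<open>a \<cong> a\<close> in the last condition holds for every regular a.
\<close>

lemma (in monoid) Units_mult_eq_imp_eq_inv_mult:
  assumes "a = u \<otimes> b" and "u \<in> Units G" and "b \<in> carrier G"
  shows "b = inv u \<otimes> a"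
  using assms m_assoc[of "inv u" u b] by (simp add: Units_closed)

lemma (in comm_monoid) foldr_nonunits_unit_imp_Nil:
  assumes "set as \<subseteq> carrier G - Units G" and "foldr (\<otimes>) as \<one> \<in> Units G"
  shows "as = []"
proof (cases as)
  case (Cons x xs)
  with assms have x: "x \<in> carrier G" "x \<notin> Units G" and "set xs \<subseteq> carrier G"
    by auto
  from this(3) have "foldr (\<otimes>) xs \<one> \<in> carrier G"
    by (rule multlist_closed)
  with assms(2) x Cons show ?thesis
    using unit_factor[of x "foldr (\<otimes>) xs \<one>"] by simp
qed

context cring
begin

lemma regular_mult_fixed_imp_one:
  assumes "a \<in> regular_elements R" and "t \<in> carrier R" and "a = t \<otimes> a"
  shows "t = \<one>"
proof -
  have a: "a \<in> carrier R"
    using assms(1) by (simp add: regular_elements_def)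
  have "a \<otimes> (t \<ominus> \<one>) = t \<otimes> a \<ominus> a"
    using a assms(2) by algebra
  also have "\<dots> = \<zero>"
    using a unfolding assms(3)[symmetric] by algebra
  finally have "t \<ominus> \<one> = \<zero>"
    using assms(1,2) by (auto simp: regular_elements_def)
  moreover have "t = (t \<ominus> \<one>) \<oplus> \<one>"
    using assms(2) by algebra
  ultimately show ?thesis
    by simp
qed

lemma ideal_assoc_imp_multiple:
  assumes "ideal_assoc R a b" and "b \<in> carrier R"
  obtains s where "s \<in> carrier R" and "b = s \<otimes> a"
proof -
  have "b \<in> PIdl a"
    using cgenideal_self[OF assms(2)] assms(1) by (simp add: ideal_assoc_def)
  with that show ?thesis
    by (auto simp: cgenideal_def)
qed

lemma strong_assoc_imp_ideal_assoc:
  assumes "strong_assoc R a b" and "b \<in> carrier R"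
  shows "ideal_assoc R a b"
proof -
  obtain u where u: "u \<in> Units R" and a: "a = u \<otimes> b"
    using assms(1) by (auto simp: strong_assoc_def)
  have b: "b = inv u \<otimes> a"
    using a u assms(2) by (rule Units_mult_eq_imp_eq_inv_mult)
  have "a \<in> carrier R"
    using u a assms(2) by (simp add: Units_closed)
  moreover have "a \<in> PIdl b"
    unfolding cgenideal_def using u a by blast
  moreover have "b \<in> PIdl a"
    unfolding cgenideal_def using u b by blast
  ultimately show ?thesis
    using assms(2) by (simp add: ideal_assoc_def cgenideal_minimal cgenideal_ideal subset_antisym)
qed

text \<open>
  On regular elements, \<open>\<approx>\<close> and \<open>\<cong>\<close> agree: the multiplier carrying b to a can be cancelled
  against any other one.
\<close>

lemma regular_strong_assoc_imp_very_strong_assoc: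
  assumes "a \<in> regular_elements R" and "strong_assoc R a b" and "b \<in> carrier R"
  shows "very_strong_assoc R a b"
proof -
  obtain u where u: "u \<in> Units R" and a: "a = u \<otimes> b"
    using assms(2) by (auto simp: strong_assoc_def)
  have "r \<in> Units R" if r: "r \<in> carrier R" and ar: "a = r \<otimes> b" for r
  proof -
    have b: "b = inv u \<otimes> a"
      using a u assms(3) by (rule Units_mult_eq_imp_eq_inv_mult)
    have "a \<in> carrier R"
      using u a assms(3) by (simp add: Units_closed)
    then have "(r \<otimes> inv u) \<otimes> a = r \<otimes> b"
      unfolding b using r u by (simp add: m_assoc)
    then have "a = (r \<otimes> inv u) \<otimes> a"
      using ar by metis
    moreover have "r \<otimes> inv u \<in> carrier R"
      using r u by simp
    ultimately have "r \<otimes> inv u = \<one>"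
      using regular_mult_fixed_imp_one[OF assms(1)] by blast
    then show ?thesis
      using r u unit_factor[of r "inv u"] by simp
  qed
  then show ?thesis
    using strong_assoc_imp_ideal_assoc[OF assms(2,3)] by (simp add: very_strong_assoc_def)
qed

text \<open>
  The factor x associated with a absorbs all of a, so the remaining factors multiply to a unit
  and hence are absent. This cancellation is where regularity of a is indispensable: a
  nontrivial idempotent e has the factorization \<open>e = e e\<close>, in which both factors generate
  \<open>(e)\<close>.
\<close>

lemma ideal_assoc_factor_imp_trivial:
  assumes fact: "tau_regular_factorization R \<tau> a u as"
    and i: "i < length as" and assoc: "ideal_assoc R a (as ! i)"
  shows "as = [inv u \<otimes> a]"
proof -
  have reg: "a \<in> regular_elements R" and u: "u \<in> Units R" and nonu: "set as \<subseteq> nonunits R"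
    and prod: "a = u \<otimes> foldr (\<otimes>) as \<one>"
    using fact by (auto simp: tau_regular_factorization_def tau_factorization_def)
  have a: "a \<in> carrier R"
    using reg by (simp add: regular_elements_def)
  define x xs ys where "x = as ! i" and "xs = take i as" and "ys = drop (Suc i) as"
  have split: "as = xs @ x # ys"
    using i by (simp add: x_def xs_def ys_def id_take_nth_drop)
  define b where "b = foldr (\<otimes>) (xs @ ys) \<one>"
  have carr: "set as \<subseteq> carrier R"
    using nonu by (auto simp: nonunits_def)
  have x: "x \<in> carrier R"
    using carr split by simp
  have b: "b \<in> carrier R"
    unfolding b_def using carr split by (intro multlist_closed) simp
  have axb: "a = u \<otimes> (x \<otimes> b)"
    using prod carr multlist_perm_cong[of as "x # xs @ ys"] by (simp add: split b_def)
  obtain s where s: "s \<in> carrier R" and xa: "x = s \<otimes> a"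
    using ideal_assoc_imp_multiple[OF assoc] x by (auto simp: x_def)
  have "a = u \<otimes> ((s \<otimes> a) \<otimes> b)"
    using axb unfolding xa .
  also have "\<dots> = (b \<otimes> (u \<otimes> s)) \<otimes> a"
    using u[THEN Units_closed] s a b by algebra
  finally have "a = (b \<otimes> (u \<otimes> s)) \<otimes> a" .
  moreover have "b \<otimes> (u \<otimes> s) \<in> carrier R"
    using u s b by (simp add: Units_closed)
  ultimately have "b \<otimes> (u \<otimes> s) = \<one>"
    using regular_mult_fixed_imp_one[OF reg] by blast
  then have "b \<in> Units R"
    using unit_factor[of b "u \<otimes> s"] u s b by (simp add: Units_closed)
  moreover have "set (xs @ ys) \<subseteq> nonunits R"
    using nonu split by auto
  ultimately have nil: "xs @ ys = []"
    unfolding b_def nonunits_def using foldr_nonunits_unit_imp_Nil by blast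
  then have "a = u \<otimes> x"
    using axb x by (simp add: b_def)
  then have "x = inv u \<otimes> a"
    using u x by (rule Units_mult_eq_imp_eq_inv_mult)
  then show ?thesis
    using split nil by simp
qed

lemma trivial_factorization_strong_assoc:
  assumes "tau_regular_factorization R \<tau> a u [x]"
  shows "strong_assoc R a x" and "x \<in> carrier R"
  using assms
  by (auto simp: tau_regular_factorization_def tau_factorization_def strong_assoc_def nonunits_def)

text \<open>
  The relation \<open>\<rho>\<close> is left open so that each of the three associate relations can be
  substituted for it: the first bound lets the cancellation argument start, the second lets a
  trivial factorization pass the test.
\<close>

lemma related_factor_iff_trivial:
  assumes fact: "tau_regular_factorization R \<tau> a u as"
    and weak: "\<And>x. x \<in> carrier R \<Longrightarrow> \<rho> a x \<Longrightarrow> ideal_assoc R a x"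
    and strong: "\<And>x. x \<in> carrier R \<Longrightarrow> strong_assoc R a x \<Longrightarrow> \<rho> a x"
  shows "(\<exists>i < length as. \<rho> a (as ! i)) \<longleftrightarrow> as = [inv u \<otimes> a]"
proof
  assume "\<exists>i < length as. \<rho> a (as ! i)"
  then obtain i where i: "i < length as" "\<rho> a (as ! i)"
    by blast
  have "as ! i \<in> carrier R"
    using fact nth_mem[OF i(1)]
    by (auto simp: tau_regular_factorization_def tau_factorization_def nonunits_def)
  with i weak ideal_assoc_factor_imp_trivial[OF fact] show "as = [inv u \<otimes> a]"
    by blast
next
  assume as: "as = [inv u \<otimes> a]"
  with fact have triv: "tau_regular_factorization R \<tau> a u [inv u \<otimes> a]"
    by simp
  show "\<exists>i < length as. \<rho> a (as ! i)"
    using as strong trivial_factorization_strong_assoc[OF triv] by simp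
qed

end

theorem proposition3p1:
  fixes R :: "('a, 'm) ring_scheme" and \<tau> :: "('a \<times> 'a) set" and a :: 'a
  assumes "cring R" and "\<one>\<^bsub>R\<^esub> \<noteq> \<zero>\<^bsub>R\<^esub>"
    and "\<tau> \<subseteq> nonzero_nonunits R \<times> nonzero_nonunits R" and "sym \<tau>"
    and "a \<in> regular_elements R"
  defines "c1 \<equiv> \<forall>u as. tau_regular_factorization R \<tau> a u as \<longrightarrow>
                  (\<exists>i < length as. ideal_assoc R a (as ! i))"
    and "c2 \<equiv> \<forall>u as. tau_regular_factorization R \<tau> a u as \<longrightarrow>
                  (\<exists>i < length as. strong_assoc R a (as ! i))"
    and "c3 \<equiv> \<forall>u as. tau_regular_factorization R \<tau> a u as \<longrightarrow>
                  (\<forall>i < length as. ideal_assoc R a (as ! i))"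
    and "c4 \<equiv> \<forall>u as. tau_regular_factorization R \<tau> a u as \<longrightarrow>
                  as = [inv\<^bsub>R\<^esub> u \<otimes>\<^bsub>R\<^esub> a]"
    and "c5 \<equiv> very_strong_assoc R a a \<and>
               (\<forall>u as. tau_regular_factorization R \<tau> a u as \<longrightarrow>
                  (\<exists>i < length as. very_strong_assoc R a (as ! i)))"
  shows "(c1 \<longleftrightarrow> c2) \<and> (c2 \<longleftrightarrow> c3) \<and> (c3 \<longleftrightarrow> c4) \<and> (c4 \<longleftrightarrow> c5)"
proof -
  interpret cring R by fact
  have some_ideal: "(\<exists>i < length as. ideal_assoc R a (as ! i)) \<longleftrightarrow> as = [inv\<^bsub>R\<^esub> u \<otimes>\<^bsub>R\<^esub> a]"
    if "tau_regular_factorization R \<tau> a u as" for u as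
    using related_factor_iff_trivial[OF that, of "ideal_assoc R"] strong_assoc_imp_ideal_assoc
    by blast
  have some_strong: "(\<exists>i < length as. strong_assoc R a (as ! i)) \<longleftrightarrow> as = [inv\<^bsub>R\<^esub> u \<otimes>\<^bsub>R\<^esub> a]"
    if "tau_regular_factorization R \<tau> a u as" for u as
    using related_factor_iff_trivial[OF that, of "strong_assoc R"] strong_assoc_imp_ideal_assoc
    by blast
  have some_very_strong:
    "(\<exists>i < length as. very_strong_assoc R a (as ! i)) \<longleftrightarrow> as = [inv\<^bsub>R\<^esub> u \<otimes>\<^bsub>R\<^esub> a]"
    if "tau_regular_factorization R \<tau> a u as" for u as
    using related_factor_iff_trivial[OF that, of "very_strong_assoc R"]
      regular_strong_assoc_imp_very_strong_assoc[OF \<open>a \<in> regular_elements R\<close>]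
    by (auto simp: very_strong_assoc_def)
  have all_ideal: "(\<forall>i < length as. ideal_assoc R a (as ! i)) \<longleftrightarrow> as = [inv\<^bsub>R\<^esub> u \<otimes>\<^bsub>R\<^esub> a]"
    if f: "tau_regular_factorization R \<tau> a u as" for u as
  proof
    assume "\<forall>i < length as. ideal_assoc R a (as ! i)"
    moreover have "0 < length as"
      using f by (simp add: tau_regular_factorization_def tau_factorization_def)
    ultimately show "as = [inv\<^bsub>R\<^esub> u \<otimes>\<^bsub>R\<^esub> a]"
      using some_ideal[OF f] by blast
  next
    assume "as = [inv\<^bsub>R\<^esub> u \<otimes>\<^bsub>R\<^esub> a]"
    then show "\<forall>i < length as. ideal_assoc R a (as ! i)"
      using some_ideal[OF f] by simp
  qed
  have "a \<in> carrier R"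
    using \<open>a \<in> regular_elements R\<close> by (simp add: regular_elements_def)
  then have "strong_assoc R a a"
    using l_one[of a] Units_one_closed unfolding strong_assoc_def by metis
  then have "very_strong_assoc R a a"
    using regular_strong_assoc_imp_very_strong_assoc \<open>a \<in> regular_elements R\<close> \<open>a \<in> carrier R\<close>
    by blast
  then show ?thesis
    unfolding c1_def c2_def c3_def c4_def c5_def
    using some_ideal some_strong some_very_strong all_ideal by simp
qed

end
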